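(* Let $(X,\|\cdot\|)$ be a Banach space, let $S\subseteq X$ be nonempty and closed, and let $(\mathbb{P},\|\cdot\|_{\mathbb{P}})$ be a perturbation space in the strong sense on $S$. Let $f:X\to\mathbb{R}\cup\{+\infty\}$ be a function which is proper, lower semicontinuous and bounded below on $S$. Then the set $$A=\{h\in\mathbb{P}:\ \text{the minimization problem } (f+h,S)\text{ is not WPMC}\}$$ is $\sigma$-porous in the metric space $\mathbb{P}$ (with the metric induced by $\|\cdot\|_{\mathbb{P}}$).
   Context: For a nonempty set $B\subset X$, $\alpha(B)$ denotes the index of non-compactness: the infimum of all $\varepsilon>0$ for which $B$ admits a finite $\varepsilon$-net. For $f:X\to\mathbb{R}\cup\{+\infty\}$ and $\varepsilon\ge 0$ put $\Omega_f^S(\varepsilon)=\{x\in S: f(x)\le \inf_S f+\varepsilon\}$; so $\Omega_f^S(0)=\operatorname{argmin}_S f$. WPMC: the minimization problem $(f,S)$ (minimize $f$ over $S$) is well-posed modulus compact (WPMC) if $\inf_S f\in\mathbb{R}$, $\Omega_f^S(0)$ is nonempty and compact, and for every sequence $(x_n)\subset S$ with $f(x_n)\to\min_S f$ one has $d(x_n,\Omega_f^S(0))\to 0$. Proper on $S$ means that $f$ is not identically $+\infty$ on $S$. Perturbation space in the strong sense on $S$: a set $\mathbb{P}$ of real-valued functions on $X$, continuous and bounded on $S$, with a norm $\|\cdot\|_{\mathbb{P}}$ on $\operatorname{span}\mathbb{P}$, such that (i) $\mathbb{P}$ is a convex cone; (ii) $\mathbb{P}$ is complete with respect to $\|\cdot\|_{\mathbb{P}}$,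 and the norm dominates uniform convergence on $S$: there is a constant $C>0$ with $\sup_{x\in S}|g(x)|\le C\|g\|_{\mathbb{P}}$ for all $g\in\operatorname{span}\mathbb{P}$ (in other words $(\operatorname{span}\mathbb{P},\|\cdot\|_{\mathbb{P}})$ is a Banach space and $\mathbb{P}$ is its positive cone); (iii) for every $n\in\mathbb{N}$ there is $K_n\in(0,6C)$ such that for every $\varepsilon>0$ and every $x\in S$ there is $g\in\mathbb{P}$ (depending on $x$ and $\varepsilon$) such that, with $\delta=K_n\varepsilon$, $\|g\|_{\mathbb{P}}\le\varepsilon$, $x\in\Omega_g^S(\delta)$ and $\alpha(\Omega_g^S(3\delta))\le \frac1n$. Porosity: a subset $A$ of a metric space $(Y,\rho)$ is porous in $Y$ if there exist $\alpha>0$ and $r_0>0$ such that for every $r\in(0,r_0)$ and every $x\in A$ there is $z\in Y$ with $B(z,\alpha r)\subset B(x,r)\setminus A$ (open balls of $Y$). A set is $\sigma$-porous in $Y$ if it is a countable union of sets porous in $Y$. *)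

theory Defs
  imports "HOL-Analysis.Analysis" "HOL-Library.Function_Algebras"
begin

text \<open>
  Functions with values in a real vector space form a real vector space under the pointwise
  operations. The additive structure comes from \<^theory>\<open>HOL-Library.Function_Algebras\<close>; with the
  scalar multiplication below, \<^const>\<open>span\<close>, \<^const>\<open>convex\<close> and \<^const>\<open>convex_cone\<close>
  apply to sets of real-valued functions.
\<close>

instantiation "fun" :: (type, real_vector) real_vector
begin

definition scaleR_fun :: "real \<Rightarrow> ('a \<Rightarrow> 'b) \<Rightarrow> 'a \<Rightarrow> 'b"
  where "scaleR_fun c g = (\<lambda>x. c *\<^sub>R g x)"

instance
  by standard (auto simp: scaleR_fun_def plus_fun_def fun_eq_iff scaleR_add_right scaleR_add_left)

end

subsection \<open>Index of non-compactness\<close>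

text \<open>
  The centres of the net are arbitrary points of the space. The value is \<open>\<infinity>\<close> if there is no
  finite \<open>\<epsilon>\<close>-net for any \<open>\<epsilon>\<close>.
\<close>

definition finite_net :: "'a::metric_space set \<Rightarrow> real \<Rightarrow> bool"
  where "finite_net B \<epsilon> \<longleftrightarrow> (\<exists>F. finite F \<and> (\<forall>x\<in>B. \<exists>y\<in>F. dist x y \<le> \<epsilon>))"

definition noncompactness_index :: "'a::metric_space set \<Rightarrow> ereal"
  where "noncompactness_index B = Inf {ereal \<epsilon> |\<epsilon>. \<epsilon> > 0 \<and> finite_net B \<epsilon>}"

subsection \<open>Minimization problems\<close>

definition sublevel :: "'a set \<Rightarrow> ('a \<Rightarrow> ereal) \<Rightarrow> real \<Rightarrow> 'a set"
  where "sublevel S f \<epsilon> = {x \<in> S. f x \<le> (INF y\<in>S. f y) + ereal \<epsilon>}"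

definition WPMC :: "('a::metric_space \<Rightarrow> ereal) \<Rightarrow> 'a set \<Rightarrow> bool"
  where "WPMC f S \<longleftrightarrow>
    \<bar>INF y\<in>S. f y\<bar> \<noteq> \<infinity> \<and>
    sublevel S f 0 \<noteq> {} \<and> compact (sublevel S f 0) \<and>
    (\<forall>x :: nat \<Rightarrow> 'a. (\<forall>n. x n \<in> S) \<longrightarrow> (\<lambda>n. f (x n)) \<longlonglongrightarrow> (INF y\<in>S. f y) \<longrightarrow>
       (\<lambda>n. infdist (x n) (sublevel S f 0)) \<longlonglongrightarrow> 0)"

definition proper_on :: "'a set \<Rightarrow> ('a \<Rightarrow> ereal) \<Rightarrow> bool"
  where "proper_on S f \<longleftrightarrow> (\<exists>x\<in>S. f x \<noteq> \<infinity>)"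

definition lsc_on :: "'a::topological_space set \<Rightarrow> ('a \<Rightarrow> ereal) \<Rightarrow> bool"
  where "lsc_on S f \<longleftrightarrow> (\<forall>x\<in>S. f x \<le> Liminf (at x within S) f)"

definition bounded_below_on :: "'a set \<Rightarrow> ('a \<Rightarrow> ereal) \<Rightarrow> bool"
  where "bounded_below_on S f \<longleftrightarrow> (\<exists>m::real. \<forall>x\<in>S. ereal m \<le> f x)"

subsection \<open>Perturbation spaces\<close>

definition norm_on :: "'v::real_vector set \<Rightarrow> ('v \<Rightarrow> real) \<Rightarrow> bool"
  where "norm_on V N \<longleftrightarrow>
    (\<forall>v\<in>V. 0 \<le> N v \<and> (N v = 0 \<longleftrightarrow> v = 0)) \<and>
    (\<forall>c. \<forall>v\<in>V. N (c *\<^sub>R v) = \<bar>c\<bar> * N v) \<and>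
    (\<forall>v\<in>V. \<forall>w\<in>V. N (v + w) \<le> N v + N w)"

text \<open>
  The metric induced by a norm on \<open>V\<close>. The locale \<^locale>\<open>Metric_space\<close> requires non-negativity
  and symmetry also outside its carrier, hence the default value 0 there.
\<close>

definition norm_metric :: "'v::real_vector set \<Rightarrow> ('v \<Rightarrow> real) \<Rightarrow> 'v \<Rightarrow> 'v \<Rightarrow> real"
  where "norm_metric V N v w = (if v \<in> V \<and> w \<in> V then N (v - w) else 0)"

lemma Metric_space_norm_metric:
  assumes V: "subspace V" and N: "norm_on V N"
  shows "Metric_space V (norm_metric V N)"
proof
  have diff: "v - w \<in> V" if "v \<in> V" "w \<in> V" for v w
    using V that by (rule subspace_diff)
  have nonneg: "0 \<le> N v" and zero: "N v = 0 \<longleftrightarrow> v = 0"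
    and scale: "N (c *\<^sub>R v) = \<bar>c\<bar> * N v" if "v \<in> V" for c v
    using N that unfolding norm_on_def by simp_all
  have add: "N (v + w) \<le> N v + N w" if "v \<in> V" "w \<in> V" for v w
    using N that unfolding norm_on_def by simp
  show "0 \<le> norm_metric V N x y" for x y
    using nonneg[OF diff] by (simp add: norm_metric_def)
  show "norm_metric V N x y = norm_metric V N y x" for x y
    using scale[OF diff, of x y "-1"] by (simp add: norm_metric_def)
  show "norm_metric V N x y = 0 \<longleftrightarrow> x = y" if "x \<in> V" "y \<in> V" for x y
    using zero[OF diff[OF that]] that by (simp add: norm_metric_def)
  show "norm_metric V N x z \<le> norm_metric V N x y + norm_metric V N y z"
    if "x \<in> V" "y \<in> V" "z \<in> V" for x y z
    using add[OF diff diff, of x y y z] that by (simp add: norm_metric_def)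
qed

text \<open>
  The constant \<open>C\<close> of the domination inequality is the one that bounds the \<open>K\<^sub>n\<close>.
\<close>

definition strong_perturbation_space ::
    "'a::metric_space set \<Rightarrow> ('a \<Rightarrow> real) set \<Rightarrow> (('a \<Rightarrow> real) \<Rightarrow> real) \<Rightarrow> bool"
  where "strong_perturbation_space S P N \<longleftrightarrow>
    (\<forall>g\<in>P. continuous_on S g \<and> bounded (g ` S)) \<and>
    norm_on (span P) N \<and>
    convex_cone P \<and>
    Metric_space.mcomplete P (norm_metric (span P) N) \<and>
    (\<exists>C>0.
      (\<forall>g\<in>span P. \<forall>x\<in>S. \<bar>g x\<bar> \<le> C * N g) \<and>
      (\<forall>n::nat. n \<ge> 1 \<longrightarrow>
        (\<exists>K. 0 < K \<and> K < 6 * C \<and>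
          (\<forall>\<epsilon>>0. \<forall>x\<in>S. \<exists>g\<in>P.
            N g \<le> \<epsilon> \<and>
            x \<in> sublevel S (\<lambda>y. ereal (g y)) (K * \<epsilon>) \<and>
            noncompactness_index (sublevel S (\<lambda>y. ereal (g y)) (3 * (K * \<epsilon>)))
              \<le> ereal (1 / real n)))))"

subsection \<open>Porosity\<close>

definition porous_in :: "'y set \<Rightarrow> ('y \<Rightarrow> 'y \<Rightarrow> real) \<Rightarrow> 'y set \<Rightarrow> bool"
  where "porous_in Y d A \<longleftrightarrow> A \<subseteq> Y \<and>
    (\<exists>\<alpha>>0. \<exists>r0>0. \<forall>r. 0 < r \<and> r < r0 \<longrightarrow>
      (\<forall>x\<in>A. \<exists>z\<in>Y.
        Metric_space.mball Y d z (\<alpha> * r) \<subseteq> Metric_space.mball Y d x r - A))"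

definition sigma_porous_in :: "'y set \<Rightarrow> ('y \<Rightarrow> 'y \<Rightarrow> real) \<Rightarrow> 'y set \<Rightarrow> bool"
  where "sigma_porous_in Y d A \<longleftrightarrow>
    (\<exists>\<A>. countable \<A> \<and> (\<forall>B\<in>\<A>. porous_in Y d B) \<and> A = \<Union>\<A>)"

end

theory Submission
  imports Defs
begin

text \<open>
  If the indices of non-compactness of the sublevel sets \<open>\<Omega>\<^sub>f\<^sub>+\<^sub>h(s)\<close> tend to \<open>0\<close> as \<open>s \<rightarrow> 0\<close>, then every
  minimizing sequence has a convergent subsequence, and by lower semicontinuity its limit is a
  minimizer; this gives WPMC. Hence \<open>A\<close> is the union of the sets \<open>A\<^sub>n\<close> of those \<open>h \<in> A\<close> for which
  all these indices exceed \<open>1/n\<close>. To see that \<open>A\<^sub>n\<close> is porous, take an almost-minimizer \<open>x\<close> of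
  \<open>f + h\<close> and the function \<open>g\<close> of norm at most \<open>r/2\<close> that condition (iii) provides for \<open>x\<close>. For \<open>h'\<close>
  close to \<open>h + g\<close>, comparison with the value at \<open>x\<close> shows that small sublevel sets of \<open>f + h'\<close> are
  contained in \<open>\<Omega>\<^sub>g(3\<delta>)\<close>, so \<open>h' \<notin> A\<^sub>n\<close>.
\<close>

section \<open>Finite nets and total boundedness\<close>

lemma finite_net_mono:
  assumes "finite_net B e" "A \<subseteq> B" "e \<le> e'"
  shows "finite_net A e'"
  using assms unfolding finite_net_def by (meson order_trans subsetD)

lemma noncompactness_index_mono:
  assumes "A \<subseteq> B"
  shows "noncompactness_index A \<le> noncompactness_index B"
  unfolding noncompactness_index_def
  by (rule Inf_superset_mono) (use assms finite_net_mono in blast)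

lemma finite_net_if_noncompactness_index_less:
  assumes "noncompactness_index B < ereal e"
  shows "finite_net B e"
proof -
  obtain e' where "finite_net B e'" "e' < e"
    using assms unfolding noncompactness_index_def Inf_less_iff by auto
  then show ?thesis
    using finite_net_mono by (metis less_imp_le order_refl)
qed

lemma compact_closure_if_finite_nets:
  fixes B :: "'a::complete_space set"
  assumes "\<And>e. e > 0 \<Longrightarrow> finite_net B e"
  shows "compact (closure B)"
  unfolding compact_eq_totally_bounded
proof (intro conjI allI impI)
  show "complete (closure B)"
    by (simp add: complete_eq_closed)
next
  fix e :: real assume "e > 0"
  then obtain F where F: "finite F" "\<And>x. x \<in> B \<Longrightarrow> \<exists>y\<in>F. dist x y \<le> e / 2"
    using assms[of "e / 2"] unfolding finite_net_def by auto
  \<comment> \<open>A finite union of closed balls is closed and so absorbs the closure; halving the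
    radius lets these balls fit into open balls of radius \<open>e\<close>.\<close>
  have "closure B \<subseteq> (\<Union>y\<in>F. cball y (e / 2))"
  proof (rule closure_minimal)
    show "B \<subseteq> (\<Union>y\<in>F. cball y (e / 2))"
      using F(2) by (fastforce simp: dist_commute)
    show "closed (\<Union>y\<in>F. cball y (e / 2))"
      using F(1) by auto
  qed
  also have "\<dots> \<subseteq> (\<Union>y\<in>F. ball y e)"
    using \<open>e > 0\<close> by (intro UN_mono) auto
  finally show "\<exists>F. finite F \<and> closure B \<subseteq> (\<Union>y\<in>F. ball y e)"
    using F(1) by blast
qed

section \<open>Lower semicontinuous functions and their infima\<close>

lemma lsc_on_le_limit:
  fixes f :: "'a::topological_space \<Rightarrow> ereal"
  assumes "lsc_on S f" "\<And>n. x n \<in> S" "x \<longlonglongrightarrow> l" "l \<in> S" "(\<lambda>n. f (x n)) \<longlonglongrightarrow> m"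
  shows "f l \<le> m"
proof (rule dense_le)
  fix c assume c: "c < f l"
  then have "c < Liminf (at l within S) f"
    using assms(1,4) unfolding lsc_on_def by (meson less_le_trans)
  then have "eventually (\<lambda>y. c < f y) (at l within S)"
    by (rule less_LiminfD)
  then obtain U where U: "open U" "l \<in> U" "\<And>y. y \<in> U \<Longrightarrow> y \<noteq> l \<Longrightarrow> y \<in> S \<Longrightarrow> c < f y"
    unfolding eventually_at_topological by auto
  have "eventually (\<lambda>n. x n \<in> U) sequentially"
    using assms(3) U(1,2) by (rule topological_tendstoD)
  \<comment> \<open>The filter \<open>at l within S\<close> is punctured, so \<open>U(3)\<close>
    says nothing about terms equal to \<open>l\<close>; for those the bound is \<open>c\<close>
    itself.\<close>
  then have "eventually (\<lambda>n. c \<le> f (x n)) sequentially"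
    by eventually_elim (use U(3) c assms(2) in \<open>metis less_imp_le\<close>)
  then show "c \<le> m"
    using assms(5) by (intro tendsto_lowerbound[of "\<lambda>n. f (x n)"]) auto
qed

text \<open>A real \<open>a\<close> strictly between \<open>y\<close> and the value at
  \<open>x\<close> is split as \<open>c + (a - c)\<close> with \<open>c\<close> below
  \<open>f x\<close> and \<open>a - c\<close> below \<open>h x\<close>. Both strict bounds persist
  near \<open>x\<close>. Passing through reals covers infinite values of \<open>f\<close> and
  \<open>y\<close>.\<close>

lemma lsc_on_add_continuous:
  fixes f :: "'a::t2_space \<Rightarrow> ereal"
  assumes "lsc_on S f" "continuous_on S h"
  shows "lsc_on S (\<lambda>x. f x + ereal (h x))"
  unfolding lsc_on_def le_Liminf_iff
proof (intro ballI allI impI)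
  fix x y assume x: "x \<in> S" and y: "y < f x + ereal (h x)"
  obtain a where a: "y < ereal a" "ereal a < f x + ereal (h x)"
    using ereal_dense2[OF y] by blast
  have "ereal (a - h x) < f x"
    using a(2) by (cases "f x") auto
  then obtain c where c: "a - h x < c" "ereal c < f x"
    using ereal_dense2 by force
  have "ereal c < Liminf (at x within S) f"
    using assms(1) x c(2) unfolding lsc_on_def by (meson less_le_trans)
  then have "eventually (\<lambda>z. ereal c < f z) (at x within S)"
    by (rule less_LiminfD)
  moreover have "(h \<longlongrightarrow> h x) (at x within S)"
    using assms(2) x by (simp add: continuous_on_def)
  then have "eventually (\<lambda>z. a - c < h z) (at x within S)"
    by (rule order_tendstoD) (use c(1) in simp)
  ultimately show "eventually (\<lambda>z. y < f z + ereal (h z)) (at x within S)"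
  proof eventually_elim
    case (elim z)
    then have "ereal a < f z + ereal (h z)"
      by (cases "f z") auto
    with a(1) show ?case
      by (rule less_trans)
  qed
qed

lemma bounded_below_on_add_bounded:
  assumes "bounded_below_on S f" "bounded (h ` S)"
  shows "bounded_below_on S (\<lambda>x. f x + ereal (h x))"
proof -
  obtain m where m: "\<And>x. x \<in> S \<Longrightarrow> ereal m \<le> f x"
    using assms(1) unfolding bounded_below_on_def by blast
  obtain b where b: "\<And>x. x \<in> S \<Longrightarrow> \<bar>h x\<bar> \<le> b"
    using assms(2) unfolding bounded_iff by auto
  have "ereal (m + - b) \<le> f x + ereal (h x)" if "x \<in> S" for x
    unfolding plus_ereal.simps(1)[symmetric]
    using m[OF that] b[OF that] by (intro add_mono) auto
  then show ?thesis unfolding bounded_below_on_def by blast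
qed

lemma proper_on_add_real:
  "proper_on S f \<Longrightarrow> proper_on S (\<lambda>x. f x + ereal (h x))"
  unfolding proper_on_def by auto

lemma finite_INF_if_proper_bounded_below:
  assumes "proper_on S f" "bounded_below_on S f"
  shows "\<bar>INF x\<in>S. f x\<bar> \<noteq> \<infinity>"
proof -
  obtain m where "\<And>x. x \<in> S \<Longrightarrow> ereal m \<le> f x"
    using assms(2) unfolding bounded_below_on_def by blast
  then have "ereal m \<le> (INF x\<in>S. f x)"
    by (intro INF_greatest)
  moreover obtain x where "x \<in> S" "f x \<noteq> \<infinity>"
    using assms(1) unfolding proper_on_def by blast
  then have "(INF x\<in>S. f x) < \<infinity>"
    using INF_lower[of x S f] by (metis ereal_infty_less(1) le_less_trans)
  ultimately show ?thesis by auto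
qed

section \<open>Minimizing sequences and well-posedness\<close>

lemma sublevel_nonempty:
  assumes "\<bar>INF x\<in>S. f x\<bar> \<noteq> \<infinity>" "e > 0"
  shows "sublevel S f e \<noteq> {}"
proof -
  have "(INF x\<in>S. f x) < (INF x\<in>S. f x) + ereal e"
    using assms by (cases "INF x\<in>S. f x") auto
  then obtain x where "x \<in> S" "f x < (INF x\<in>S. f x) + ereal e"
    unfolding INF_less_iff by blast
  then show ?thesis
    unfolding sublevel_def by force
qed

text \<open>All but finitely many terms lie in any given sublevel set with positive
  \<open>s\<close>. A net of that set, enlarged by the remaining terms, is a net of the whole range,
  which is therefore relatively compact.\<close>

lemma minimizing_sequence_convergent_subsequence:
  fixes S :: "'a::complete_space set"
  assumes fin: "\<bar>INF y\<in>S. f y\<bar> \<noteq> \<infinity>"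
    and nets: "\<And>e. e > 0 \<Longrightarrow> \<exists>s>0. finite_net (sublevel S f s) e"
    and x: "\<And>n. x n \<in> S" "(\<lambda>n. f (x n)) \<longlonglongrightarrow> (INF y\<in>S. f y)"
  obtains l and r :: "nat \<Rightarrow> nat" where "strict_mono r" "(x \<circ> r) \<longlonglongrightarrow> l"
proof -
  have "finite_net (range x) e" if e: "e > 0" for e
  proof -
    obtain s where s: "s > 0" "finite_net (sublevel S f s) e"
      using nets[OF e] by blast
    have "(INF y\<in>S. f y) < (INF y\<in>S. f y) + ereal s"
      using fin s(1) by (cases "INF x\<in>S. f x") auto
    with x(2) have "eventually (\<lambda>n. f (x n) < (INF y\<in>S. f y) + ereal s) sequentially"
      by (rule order_tendstoD(2))
    then obtain n0 where n0: "\<And>n. n \<ge> n0 \<Longrightarrow> x n \<in> sublevel S f s"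
      unfolding eventually_sequentially sublevel_def using x(1) by (auto intro: less_imp_le)
    obtain F where F: "finite F" "\<And>y. y \<in> sublevel S f s \<Longrightarrow> \<exists>z\<in>F. dist y z \<le> e"
      using s(2) unfolding finite_net_def by blast
    have "\<exists>z\<in>F \<union> x ` {..<n0}. dist (x n) z \<le> e" for n
    proof (cases "n < n0")
      case True
      then show ?thesis using e by (intro bexI[of _ "x n"]) auto
    next
      case False
      then show ?thesis using F(2)[OF n0, of n] by auto
    qed
    with F(1) show ?thesis
      unfolding finite_net_def by (intro exI[of _ "F \<union> x ` {..<n0}"]) auto
  qed
  then have "seq_compact (closure (range x))"
    using compact_closure_if_finite_nets compact_imp_seq_compact by blast
  moreover have "\<forall>n. x n \<in> closure (range x)"
    using closure_subset[of "range x"] by blast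
  ultimately obtain l r where "strict_mono r" "(x \<circ> r) \<longlonglongrightarrow> l"
    by (rule seq_compactE)
  then show ?thesis
    by (rule that)
qed

text \<open>Everything follows from \<open>subseq\<close>: a minimizing sequence has a subsequence
  converging to a minimizer. It is applied to approximate minimizers for existence, to sequences of
  minimizers for compactness, and to a subsequence staying away from the minimizers for the
  convergence of distances.\<close>

lemma WPMC_if_sublevels_finite_net:
  fixes S :: "'a::complete_space set"
  assumes "closed S" and lsc: "lsc_on S f" and fin: "\<bar>INF y\<in>S. f y\<bar> \<noteq> \<infinity>"
    and nets: "\<And>e. e > 0 \<Longrightarrow> \<exists>s>0. finite_net (sublevel S f s) e"
  shows "WPMC f S"
proof -
  let ?m = "INF y\<in>S. f y"
  have argmin: "sublevel S f 0 = {x \<in> S. f x = ?m}"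
    unfolding sublevel_def by (auto intro: antisym INF_lower)
  have subseq: "\<exists>l\<in>sublevel S f 0. \<exists>r. strict_mono r \<and> (x \<circ> r) \<longlonglongrightarrow> l"
    if x: "\<And>n. x n \<in> S" "(\<lambda>n. f (x n)) \<longlonglongrightarrow> ?m" for x :: "nat \<Rightarrow> 'a"
  proof -
    obtain l r where r: "strict_mono r" "(x \<circ> r) \<longlonglongrightarrow> l"
      using minimizing_sequence_convergent_subsequence[OF fin nets x] by blast
    have "l \<in> S"
      using \<open>closed S\<close> r(2) x(1) by (metis closed_sequentially comp_apply)
    moreover have "(\<lambda>n. f ((x \<circ> r) n)) \<longlonglongrightarrow> ?m"
      using LIMSEQ_subseq_LIMSEQ[OF x(2) r(1)] by (simp add: comp_def)
    then have "f l \<le> ?m"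
      using lsc x(1) r(2) \<open>l \<in> S\<close> by (intro lsc_on_le_limit[of S f "x \<circ> r"]) auto
    ultimately have "l \<in> sublevel S f 0"
      by (simp add: sublevel_def)
    with r show ?thesis by blast
  qed
  have "\<exists>x. \<forall>n. x n \<in> sublevel S f (1 / real (Suc n))"
    by (rule choice) (use sublevel_nonempty[OF fin] in \<open>auto simp: ex_in_conv\<close>)
  then obtain x where x: "\<And>n. x n \<in> sublevel S f (1 / real (Suc n))" by blast
  have "(\<lambda>n. f (x n)) \<longlonglongrightarrow> ?m"
  proof (rule tendsto_sandwich[of "\<lambda>_. ?m"])
    show "(\<lambda>n. ?m + ereal (1 / real (Suc n))) \<longlonglongrightarrow> ?m"
    proof -
      have "(\<lambda>n. ereal (1 / real (Suc n))) \<longlonglongrightarrow> ereal 0"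
        using LIMSEQ_inverse_real_of_nat by (simp add: inverse_eq_divide)
      then have "(\<lambda>n. ?m + ereal (1 / real (Suc n))) \<longlonglongrightarrow> ?m + ereal 0"
        using fin by (intro tendsto_add_ereal tendsto_const) auto
      then show ?thesis by simp
    qed
  qed (use x in \<open>auto simp: sublevel_def intro!: always_eventually INF_lower\<close>)
  with x have nonempty: "sublevel S f 0 \<noteq> {}"
    using subseq[of x] by (auto simp: sublevel_def)
  have "seq_compact (sublevel S f 0)"
    unfolding seq_compact_def
  proof (intro allI impI)
    fix y :: "nat \<Rightarrow> 'a" assume "\<forall>n. y n \<in> sublevel S f 0"
    then show "\<exists>l\<in>sublevel S f 0. \<exists>r. strict_mono r \<and> (y \<circ> r) \<longlonglongrightarrow> l"
      by (intro subseq) (auto simp: argmin)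
  qed
  then have compact: "compact (sublevel S f 0)"
    by (simp add: compact_eq_seq_compact_metric)
  have "(\<lambda>n. infdist (y n) (sublevel S f 0)) \<longlonglongrightarrow> 0"
    if y: "\<And>n. y n \<in> S" "(\<lambda>n. f (y n)) \<longlonglongrightarrow> ?m" for y :: "nat \<Rightarrow> 'a"
  proof (rule ccontr)
    assume "\<not> ?thesis"
    then obtain e where e: "e > 0" "\<not> eventually (\<lambda>n. infdist (y n) (sublevel S f 0) < e) sequentially"
      unfolding tendsto_iff dist_real_def by (auto simp: infdist_nonneg)
    then obtain q :: "nat \<Rightarrow> nat" where q: "strict_mono q"
        "\<And>n. \<not> infdist (y (q n)) (sublevel S f 0) < e"
      using not_eventually_sequentiallyD by blast
    \<comment> \<open>The subsequence at distance at least \<open>e\<close> from the minimizers is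
      still minimizing, so some further subsequence approaches a minimizer.\<close>
    have "(\<lambda>n. f ((y \<circ> q) n)) \<longlonglongrightarrow> ?m"
      using LIMSEQ_subseq_LIMSEQ[OF y(2) q(1)] by (simp add: comp_def)
    then obtain l r where l: "l \<in> sublevel S f 0" "((y \<circ> q) \<circ> r) \<longlonglongrightarrow> l"
      using subseq[of "y \<circ> q"] y(1) by auto
    then have "eventually (\<lambda>n. dist (((y \<circ> q) \<circ> r) n) l < e) sequentially"
      using e(1) tendstoD by blast
    then obtain n where "dist (y (q (r n))) l < e"
      unfolding eventually_sequentially by auto
    then show False
      using infdist_le[OF l(1), of "y (q (r n))"] q(2)[of "r n"] by simp
  qed
  then show ?thesis
    unfolding WPMC_def using fin nonempty compact by blast
qed

lemma WPMC_if_noncompactness_index_small: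
  fixes S :: "'a::complete_space set"
  assumes "closed S" "lsc_on S f" "\<bar>INF y\<in>S. f y\<bar> \<noteq> \<infinity>"
    and small: "\<And>n. \<exists>s>0. noncompactness_index (sublevel S f s) \<le> ereal (1 / real (Suc n))"
  shows "WPMC f S"
proof (rule WPMC_if_sublevels_finite_net[OF assms(1-3)])
  fix e :: real assume "e > 0"
  \<comment> \<open>Strictness matters: the infimum defining the index need not be attained, so a
    net of radius \<open>e\<close> is only available when the index is below
    \<open>e\<close>.\<close>
  then obtain n where n: "1 / real (Suc n) < e"
    using reals_Archimedean by (auto simp: inverse_eq_divide)
  obtain s where "s > 0" "noncompactness_index (sublevel S f s) \<le> ereal (1 / real (Suc n))"
    using small by blast
  moreover from this(2) n have "noncompactness_index (sublevel S f s) < ereal e"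
    by (rule order_le_less_trans[OF _ iffD2[OF less_ereal.simps(1)]])
  ultimately show "\<exists>s>0. finite_net (sublevel S f s) e"
    using finite_net_if_noncompactness_index_less by blast
qed

section \<open>Perturbed sublevel sets and porosity\<close>

lemma sublevel_perturbed_subset:
  assumes f: "\<forall>y. f y \<noteq> -\<infinity>"
    and fin: "\<bar>INF y\<in>S. f y + ereal (h y)\<bar> \<noteq> \<infinity>"
    and x: "x \<in> sublevel S (\<lambda>y. f y + ereal (h y)) s" "x \<in> sublevel S (\<lambda>y. ereal (g y)) \<delta>"
    and h': "\<And>y. y \<in> S \<Longrightarrow> \<bar>h y + g y - h' y\<bar> \<le> b"
  shows "sublevel S (\<lambda>y. f y + ereal (h' y)) t \<subseteq> sublevel S (\<lambda>y. ereal (g y)) (\<delta> + 2 * b + s + t)"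
proof
  fix y assume y: "y \<in> sublevel S (\<lambda>y. f y + ereal (h' y)) t"
  have S: "x \<in> S" "y \<in> S"
    using x y by (auto simp: sublevel_def)
  have "f x + ereal (h x) \<le> (INF y\<in>S. f y + ereal (h y)) + ereal s"
    using x(1) by (simp add: sublevel_def)
  also have "\<dots> < \<infinity>"
    using fin by (cases "INF y\<in>S. f y + ereal (h y)") auto
  finally obtain fx where fx: "f x = ereal fx"
    using f by (cases "f x") auto
  have "f y + ereal (h' y) \<le> (INF y\<in>S. f y + ereal (h' y)) + ereal t"
    using y by (simp add: sublevel_def)
  also have "\<dots> \<le> f x + ereal (h' x) + ereal t"
    by (intro add_right_mono INF_lower S)
  finally have 1: "f y + ereal (h' y) \<le> ereal (fx + h' x + t)"
    by (simp add: fx)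
  then obtain fy where fy: "f y = ereal fy"
    using f by (cases "f y") auto
  have "f x + ereal (h x) \<le> (INF y\<in>S. f y + ereal (h y)) + ereal s"
    using x(1) by (simp add: sublevel_def)
  also have "\<dots> \<le> f y + ereal (h y) + ereal s"
    by (intro add_right_mono INF_lower S)
  \<comment> \<open>Adding the two near-minimality inequalities cancels the finite values
    \<open>fx\<close> and \<open>fy\<close>. Replacing \<open>h'\<close> by \<open>h + g\<close>
    then costs \<open>b\<close> once at \<open>x\<close> and once at \<open>y\<close>.\<close>
  finally have "g y \<le> g x + 2 * b + s + t"
    using 1 h'[OF S(1)] h'[OF S(2)] by (simp add: fx fy)
  then have "ereal (g y) \<le> ereal (g x) + ereal (2 * b + s + t)"
    by simp
  also have "\<dots> \<le> (INF y\<in>S. ereal (g y)) + ereal \<delta> + ereal (2 * b + s + t)"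
    using x(2) by (intro add_right_mono) (simp add: sublevel_def)
  finally show "y \<in> sublevel S (\<lambda>y. ereal (g y)) (\<delta> + 2 * b + s + t)"
    using S(2) by (simp add: sublevel_def add.assoc)
qed

lemma porous_in_subset:
  assumes "porous_in Y d B" "A \<subseteq> B"
  shows "porous_in Y d A"
proof -
  obtain \<alpha> r0 where "B \<subseteq> Y" "\<alpha> > 0" "r0 > 0" and
    *: "\<And>r x. 0 < r \<Longrightarrow> r < r0 \<Longrightarrow> x \<in> B \<Longrightarrow> \<exists>z\<in>Y.
        Metric_space.mball Y d z (\<alpha> * r) \<subseteq> Metric_space.mball Y d x r - B"
    using assms(1) unfolding porous_in_def by auto
  have "\<exists>z\<in>Y. Metric_space.mball Y d z (\<alpha> * r) \<subseteq> Metric_space.mball Y d x r - A"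
    if "0 < r" "r < r0" "x \<in> A" for r x
    using *[of r x] that assms(2) by fast
  with \<open>B \<subseteq> Y\<close> \<open>\<alpha> > 0\<close> \<open>r0 > 0\<close> assms(2) show ?thesis
    unfolding porous_in_def by blast
qed

theorem theorem6:
  fixes S :: "'a::banach set"
    and P :: "('a \<Rightarrow> real) set"
    and N :: "('a \<Rightarrow> real) \<Rightarrow> real"
    and f :: "'a \<Rightarrow> ereal"
  assumes "S \<noteq> {}" and "closed S"
    and "strong_perturbation_space S P N"
    and "\<forall>x. f x \<noteq> -\<infinity>"
    and "proper_on S f" and "lsc_on S f" and "bounded_below_on S f"
  shows "sigma_porous_in P (norm_metric (span P) N)
           {h \<in> P. \<not> WPMC (\<lambda>x. f x + ereal (h x)) S}"
proof -
  let ?d = "norm_metric (span P) N"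
  let ?\<Omega> = "\<lambda>h. sublevel S (\<lambda>y. f y + ereal (h y))"
  define A where "A = {h \<in> P. \<not> WPMC (\<lambda>x. f x + ereal (h x)) S}"
  \<comment> \<open>The index bound must fail for every \<open>s\<close>, so a single small sublevel
    set shows that a function is outside \<open>B n\<close>.\<close>
  define B where "B n = {h \<in> P. \<forall>s>0. \<not> noncompactness_index (?\<Omega> h s) \<le> ereal (1 / real (Suc n))}" for n
  have P: "\<And>g. g \<in> P \<Longrightarrow> continuous_on S g \<and> bounded (g ` S)" "convex_cone P"
    and N: "norm_on (span P) N"
    using assms(3) unfolding strong_perturbation_space_def by blast+
  obtain C where C: "C > 0" "\<And>g x. g \<in> span P \<Longrightarrow> x \<in> S \<Longrightarrow> \<bar>g x\<bar> \<le> C * N g"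
    and K: "\<And>n::nat. n \<ge> 1 \<Longrightarrow> \<exists>K. 0 < K \<and> K < 6 * C \<and>
          (\<forall>\<epsilon>>0. \<forall>x\<in>S. \<exists>g\<in>P. N g \<le> \<epsilon> \<and> x \<in> sublevel S (\<lambda>y. ereal (g y)) (K * \<epsilon>) \<and>
            noncompactness_index (sublevel S (\<lambda>y. ereal (g y)) (3 * (K * \<epsilon>))) \<le> ereal (1 / real n))"
    using assms(3) unfolding strong_perturbation_space_def by blast
  \<comment> \<open>Differences of elements of the cone \<open>P\<close> may leave \<open>P\<close>,
    so the metric is obtained on \<open>span P\<close> first and then restricted.\<close>
  interpret V: Metric_space "span P" ?d
    using N by (intro Metric_space_norm_metric subspace_span)
  interpret Metric_space P ?d
    by (rule V.subspace) (rule span_superset)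
  have span: "h \<in> span P" if "h \<in> P" for h
    using that by (rule span_base)
  have fin: "\<bar>INF y\<in>S. f y + ereal (h y)\<bar> \<noteq> \<infinity>" if "h \<in> P" for h
    using assms(5,7) P(1)[OF that]
    by (intro finite_INF_if_proper_bounded_below proper_on_add_real bounded_below_on_add_bounded) auto
  have porous: "porous_in P ?d (B n)" for n
  proof -
    obtain K where K: "0 < K" "\<And>\<epsilon> x. \<epsilon> > 0 \<Longrightarrow> x \<in> S \<Longrightarrow> \<exists>g\<in>P. N g \<le> \<epsilon> \<and>
            x \<in> sublevel S (\<lambda>y. ereal (g y)) (K * \<epsilon>) \<and>
            noncompactness_index (sublevel S (\<lambda>y. ereal (g y)) (3 * (K * \<epsilon>))) \<le> ereal (1 / real (Suc n))"
      using K[of "Suc n"] by auto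
    \<comment> \<open>The bound 1/2 keeps the small ball inside the ball of radius \<open>r\<close>
      around \<open>h\<close>; the other bound makes the uniform error \<open>C * (a * r)\<close> at
      most \<open>K * r / 6\<close>.\<close>
    define a where "a = min (1 / 2) (K / (6 * C))"
    have a: "a > 0" "a \<le> 1 / 2" "6 * C * a \<le> K"
      using C(1) K(1) unfolding a_def by (auto simp: min_def field_simps)
    have "\<exists>z\<in>P. mball z (a * r) \<subseteq> mball h r - B n" if h: "h \<in> P" and r: "r > 0" for h r
    proof -
      \<comment> \<open>With \<delta> = \<open>K * r / 2\<close>, the room between \<delta> and
        3\<delta> is \<open>K * r\<close>. It is shared equally by twice the uniform error, the
        slack of \<open>x\<close> and the level used for \<open>h'\<close>.\<close>
      have Kr: "K * r / 3 > 0"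
        using K(1) r by simp
      then obtain x where x: "x \<in> ?\<Omega> h (K * r / 3)"
        using sublevel_nonempty[OF fin[OF h]] by blast
      then have "x \<in> S"
        by (simp add: sublevel_def)
      with K(2)[of "r / 2" x] r obtain g where g: "g \<in> P" "N g \<le> r / 2"
          "x \<in> sublevel S (\<lambda>y. ereal (g y)) (K * (r / 2))"
          "noncompactness_index (sublevel S (\<lambda>y. ereal (g y)) (3 * (K * (r / 2)))) \<le> ereal (1 / real (Suc n))"
        by auto
      \<comment> \<open>This is the centre of the hole; the norm of \<open>g\<close> uses up half of
        \<open>r\<close> and leaves the other half for the ball.\<close>
      have hg: "h + g \<in> P"
        using P(2) h g(1) by (rule convex_cone_add)
      have "?d h (h + g) = ?d (h + g) h"
        by (rule commute)
      then have dist_hg: "?d h (h + g) \<le> r / 2"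
        using g(2) span[OF h] span[OF hg] by (simp add: norm_metric_def)
      have "h' \<in> mball h r - B n" if "h' \<in> mball (h + g) (a * r)" for h'
      proof
        have h': "h' \<in> P" "?d (h + g) h' < a * r"
          using that by auto
        have ar: "a * r \<le> r / 2"
          using a(2) r mult_right_mono[of a "1 / 2" r] by simp
        have "?d h h' \<le> ?d h (h + g) + ?d (h + g) h'"
          using h hg h'(1) by (rule triangle)
        then show "h' \<in> mball h r"
          using h h' dist_hg ar by auto
        have dom: "\<bar>h y + g y - h' y\<bar> \<le> K * r / 6" if "y \<in> S" for y
        proof -
          have "\<bar>(h + g - h') y\<bar> \<le> C * N (h + g - h')"
            using that by (intro C(2) span_diff span hg h')
          also have "\<dots> \<le> C * (a * r)"
            using h'(2) span[OF hg] span[OF h'(1)] C(1) by (simp add: norm_metric_def)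
          also have "\<dots> \<le> K * r / 6"
            using mult_right_mono[OF a(3), of r] r by simp
          finally show ?thesis by simp
        qed
        have "?\<Omega> h' (K * r / 3) \<subseteq>
            sublevel S (\<lambda>y. ereal (g y)) (K * (r / 2) + 2 * (K * r / 6) + K * r / 3 + K * r / 3)"
          using assms(4) fin[OF h] x g(3) dom by (rule sublevel_perturbed_subset)
        also have "K * (r / 2) + 2 * (K * r / 6) + K * r / 3 + K * r / 3 = 3 * (K * (r / 2))"
          by simp
        finally have "noncompactness_index (?\<Omega> h' (K * r / 3)) \<le> ereal (1 / real (Suc n))"
          using g(4) noncompactness_index_mono order_trans by blast
        then show "h' \<notin> B n"
          using Kr unfolding B_def by blast
      qed
      with hg show ?thesis by blast
    qed
    moreover have "B n \<subseteq> P"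
      unfolding B_def by blast
    ultimately show ?thesis
      \<comment> \<open>The construction works at every scale \<open>r > 0\<close>, so the threshold
        1 is an arbitrary choice.\<close>
      unfolding porous_in_def using a(1) by (intro conjI exI[of _ a] exI[of _ 1]) auto
  qed
  have "h \<in> (\<Union>n. B n)" if "h \<in> A" for h
  proof (rule ccontr)
    assume "h \<notin> (\<Union>n. B n)"
    with that have "\<And>n. \<exists>s>0. noncompactness_index (?\<Omega> h s) \<le> ereal (1 / real (Suc n))"
      unfolding A_def B_def by blast
    then have "WPMC (\<lambda>x. f x + ereal (h x)) S"
      using assms that fin P(1) unfolding A_def
      by (intro WPMC_if_noncompactness_index_small lsc_on_add_continuous) auto
    with that show False
      unfolding A_def by blast
  qed
  \<comment> \<open>\<open>sigma_porous_in\<close> asks for an equality of sets. Intersecting with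
    \<open>A\<close> supplies it from the covering alone, and subsets of porous sets are porous with
    the same constants.\<close>
  then have "A = \<Union>(range (\<lambda>n. A \<inter> B n))"
    by auto
  moreover have "porous_in P ?d (A \<inter> B n)" for n
    using porous[of n] by (rule porous_in_subset) simp
  ultimately have "sigma_porous_in P ?d A"
    unfolding sigma_porous_in_def by (intro exI[of _ "range (\<lambda>n. A \<inter> B n)"]) auto
  then show ?thesis
    unfolding A_def .
qed

end
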